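(* Let $\bar{x}\in\mathcal{F}$ be a locally optimal solution of (MPSC). Assume that $\bar{x}$ is an $S$-stationary point of (MPSC) and that the MPSC-tailored strong second-order constraint qualification (MPSC-SSOCQ) holds at $\bar{x}$. Then the MPSC-tailored strong second-order necessary condition (MPSC-SSONC) holds at $\bar{x}$, i.e. for every multiplier $(\lambda,\rho,\mu,\nu)\in\mathbb{R}^m_+\times\mathbb{R}^p\times\mathbb{R}^l\times\mathbb{R}^l$ satisfying the $S$-stationarity system at $\bar{x}$, $$d^\top\nabla^2_{xx}\ell(\bar{x},\lambda,\rho,\mu,\nu)d\ge 0\quad\text{for all } d\in\mathcal{C}^{MPSC}_{\mathcal{F}}(\bar{x}).$$
   Context: (MPSC) is the problem: minimize $f(x)$ over $x\in\mathbb{R}^n$ subject to $g_i(x)\le 0$ ($i=1,\dots,m$), $h_j(x)=0$ ($j=1,\dots,p$), $G_k(x)H_k(x)=0$ ($k=1,\dots,l$), where $f,g_i,h_j,G_k,H_k:\mathbb{R}^n\to\mathbb{R}$ are twice continuously differentiable. $\mathcal{F}$ denotes its feasible set. For a feasible point $\bar{x}$: $\mathcal{I}_h=\{1,\dots,p\}$, $\mathcal{I}_g=\{i: g_i(\bar{x})=0\}$, $\mathcal{I}_G=\{k: G_k(\bar{x})=0,\,H_k(\bar{x})\neq0\}$, $\mathcal{I}_H=\{k: G_k(\bar{x})\ne0,\,H_k(\bar{x})=0\}$, $\mathcal{I}_{GH}=\{k: G_k(\bar{x})=H_k(\bar{x})=0\}$. Lagrangian: $\ell(x,\lambda,\rho,\mu,\nu)=f(x)+\lambda^\top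 g(x)+\rho^\top h(x)+\mu^\top G(x)+\nu^\top H(x)$. $\bar{x}\in\mathcal{F}$ is $S$-stationary if there is $(\lambda,\rho,\mu,\nu)\in\mathbb{R}^m_+\times\mathbb{R}^p\times\mathbb{R}^l\times\mathbb{R}^l$ satisfying the $S$-stationarity system: $\nabla_x\ell(\bar{x},\lambda,\rho,\mu,\nu)=0$, $\lambda^\top g(\bar{x})=0$, $\mu_k=0$ for $k\in\mathcal{I}_H$, $\nu_k=0$ for $k\in\mathcal{I}_G$, $\mu_k=\nu_k=0$ for $k\in\mathcal{I}_{GH}$. Linearization cone: $\mathcal{L}^{MPSC}_{\mathcal{F}}(\bar{x})$ is the set of $d\in\mathbb{R}^n$ with $\nabla g_i(\bar{x})^\top d\le0$ ($i\in\mathcal{I}_g$), $\nabla h_j(\bar{x})^\top d=0$ ($j\in\mathcal{I}_h$), $\nabla G_k(\bar{x})^\top d=0$ ($k\in\mathcal{I}_G$), $\nabla H_k(\bar{x})^\top d=0$ ($k\in\mathcal{I}_H$), $(\nabla G_k(\bar{x})^\top d)(\nabla H_k(\bar{x})^\top d)=0$ ($k\in\mathcal{I}_{GH}$). Critical cone: $\mathcal{C}^{MPSC}_{\mathcal{F}}(\bar{x})=\{d\in\mathcal{L}^{MPSC}_{\mathcal{F}}(\bar{x}):\nabla f(\bar{x})^\top d\le0\}$. MPSC-SSOCQ holds at $\bar{x}$ if for every nonzero $d\in\mathcal{L}^{MPSC}_{\mathcal{F}}(\bar{x})$ there exist $\delta>0$, sets $\mathcal{J},\mathcal{K}\subseteq\mathcal{I}_{GH}$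 and a twice differentiable arc $\xi:[0,\delta)\to\mathbb{R}^n$ such that $\xi(t)\in\mathcal{F}$ for all $t\in[0,\delta)$; $\xi(0)=\bar{x}$ and $\xi'_+(0)=d$ (right derivative); and for all $t\in[0,\delta)$: $g_i(\xi(t))=0$ for $i\in\mathcal{I}:=\{i\in\mathcal{I}_g:\nabla g_i(\bar{x})^\top d=0\}$, $G_k(\xi(t))=0$ for $k\in\mathcal{I}_G\cup\mathcal{J}$, $H_k(\xi(t))=0$ for $k\in\mathcal{I}_H\cup\mathcal{K}$. *)

theory Defs
  imports "HOL-Analysis.Analysis"
begin

definition grad :: "('a::real_inner \<Rightarrow> real) \<Rightarrow> 'a \<Rightarrow> 'a"
  where "grad f x = (THE D. GDERIV f x :> D)"

definition hessian :: "(real^'n \<Rightarrow> real) \<Rightarrow> real^'n \<Rightarrow> real^'n^'n"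
  where "hessian f x = jacobian (grad f) (at x)"

definition C2 :: "(real^'n \<Rightarrow> real) \<Rightarrow> bool"
  where "C2 f \<longleftrightarrow>
    (\<forall>x. f differentiable (at x)) \<and>
    (\<forall>x. grad f differentiable (at x)) \<and>
    continuous_on UNIV (hessian f)"

text \<open>
  At an endpoint belonging to the interval S the derivatives are one-sided.
\<close>

definition twice_differentiable_arc_on :: "(real \<Rightarrow> 'a::real_normed_vector) \<Rightarrow> real set \<Rightarrow> bool"
  where "twice_differentiable_arc_on \<xi> S \<longleftrightarrow>
    (\<exists>\<xi>'. (\<forall>t\<in>S. (\<xi> has_vector_derivative \<xi>' t) (at t within S)) \<and> \<xi>' differentiable_on S)"

text \<open>
  A mathematical program with switching constraints: minimize obj subject to
  ineq i x \<le> 0 (i = 1..nineq), eqn j x = 0 (j = 1..neqn) and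
  swG k x * swH k x = 0 (k = 1..nsw).  Only the constraint functions with index in
  these ranges are part of the problem; each of the three numbers may be 0.
\<close>

record ('n::finite) mpsc =
  obj :: "real^'n \<Rightarrow> real"
  nineq :: nat
  ineq :: "nat \<Rightarrow> real^'n \<Rightarrow> real"
  neqn :: nat
  eqn :: "nat \<Rightarrow> real^'n \<Rightarrow> real"
  nsw :: nat
  swG :: "nat \<Rightarrow> real^'n \<Rightarrow> real"
  swH :: "nat \<Rightarrow> real^'n \<Rightarrow> real"

definition C2_mpsc :: "('n::finite) mpsc \<Rightarrow> bool"
  where "C2_mpsc P \<longleftrightarrow>
    C2 (obj P) \<and>
    (\<forall>i\<in>{1..nineq P}. C2 (ineq P i)) \<and>
    (\<forall>j\<in>{1..neqn P}. C2 (eqn P j)) \<and>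
    (\<forall>k\<in>{1..nsw P}. C2 (swG P k) \<and> C2 (swH P k))"

definition feasible_set :: "('n::finite) mpsc \<Rightarrow> (real^'n) set"
  where "feasible_set P =
    {x. (\<forall>i\<in>{1..nineq P}. ineq P i x \<le> 0) \<and>
        (\<forall>j\<in>{1..neqn P}. eqn P j x = 0) \<and>
        (\<forall>k\<in>{1..nsw P}. swG P k x * swH P k x = 0)}"

definition locally_optimal :: "('n::finite) mpsc \<Rightarrow> real^'n \<Rightarrow> bool"
  where "locally_optimal P x \<longleftrightarrow>
    x \<in> feasible_set P \<and> (\<exists>\<epsilon>>0. \<forall>y\<in>feasible_set P \<inter> ball x \<epsilon>. obj P x \<le> obj P y)"

definition I_h :: "('n::finite) mpsc \<Rightarrow> nat set"
  where "I_h P = {1..neqn P}"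

definition I_g :: "('n::finite) mpsc \<Rightarrow> real^'n \<Rightarrow> nat set"
  where "I_g P x = {i\<in>{1..nineq P}. ineq P i x = 0}"

definition I_G :: "('n::finite) mpsc \<Rightarrow> real^'n \<Rightarrow> nat set"
  where "I_G P x = {k\<in>{1..nsw P}. swG P k x = 0 \<and> swH P k x \<noteq> 0}"

definition I_H :: "('n::finite) mpsc \<Rightarrow> real^'n \<Rightarrow> nat set"
  where "I_H P x = {k\<in>{1..nsw P}. swG P k x \<noteq> 0 \<and> swH P k x = 0}"

definition I_GH :: "('n::finite) mpsc \<Rightarrow> real^'n \<Rightarrow> nat set"
  where "I_GH P x = {k\<in>{1..nsw P}. swG P k x = 0 \<and> swH P k x = 0}"

text \<open>
  Multipliers are functions on nat of which only the values at the constraint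
  indices matter.
\<close>

definition lagrangian ::
  "('n::finite) mpsc \<Rightarrow> real^'n \<Rightarrow> (nat \<Rightarrow> real) \<Rightarrow> (nat \<Rightarrow> real) \<Rightarrow> (nat \<Rightarrow> real) \<Rightarrow> (nat \<Rightarrow> real) \<Rightarrow> real"
  where "lagrangian P x lam \<rho> \<mu> \<nu> =
    obj P x + (\<Sum>i=1..nineq P. lam i * ineq P i x) + (\<Sum>j=1..neqn P. \<rho> j * eqn P j x)
      + (\<Sum>k=1..nsw P. \<mu> k * swG P k x) + (\<Sum>k=1..nsw P. \<nu> k * swH P k x)"

definition S_stationarity_system ::
  "('n::finite) mpsc \<Rightarrow> real^'n \<Rightarrow> (nat \<Rightarrow> real) \<Rightarrow> (nat \<Rightarrow> real) \<Rightarrow> (nat \<Rightarrow> real) \<Rightarrow> (nat \<Rightarrow> real) \<Rightarrow> bool"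
  where "S_stationarity_system P x lam \<rho> \<mu> \<nu> \<longleftrightarrow>
    (\<forall>i\<in>{1..nineq P}. 0 \<le> lam i) \<and>
    grad (\<lambda>y. lagrangian P y lam \<rho> \<mu> \<nu>) x = 0 \<and>
    (\<Sum>i=1..nineq P. lam i * ineq P i x) = 0 \<and>
    (\<forall>k\<in>I_H P x. \<mu> k = 0) \<and>
    (\<forall>k\<in>I_G P x. \<nu> k = 0) \<and>
    (\<forall>k\<in>I_GH P x. \<mu> k = 0 \<and> \<nu> k = 0)"

definition S_stationary :: "('n::finite) mpsc \<Rightarrow> real^'n \<Rightarrow> bool"
  where "S_stationary P x \<longleftrightarrow>
    x \<in> feasible_set P \<and> (\<exists>lam \<rho> \<mu> \<nu>. S_stationarity_system P x lam \<rho> \<mu> \<nu>)"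

definition linearization_cone :: "('n::finite) mpsc \<Rightarrow> real^'n \<Rightarrow> (real^'n) set"
  where "linearization_cone P x =
    {d. (\<forall>i\<in>I_g P x. grad (ineq P i) x \<bullet> d \<le> 0) \<and>
        (\<forall>j\<in>I_h P. grad (eqn P j) x \<bullet> d = 0) \<and>
        (\<forall>k\<in>I_G P x. grad (swG P k) x \<bullet> d = 0) \<and>
        (\<forall>k\<in>I_H P x. grad (swH P k) x \<bullet> d = 0) \<and>
        (\<forall>k\<in>I_GH P x. (grad (swG P k) x \<bullet> d) * (grad (swH P k) x \<bullet> d) = 0)}"

definition critical_cone :: "('n::finite) mpsc \<Rightarrow> real^'n \<Rightarrow> (real^'n) set"
  where "critical_cone P x = {d \<in> linearization_cone P x. grad (obj P) x \<bullet> d \<le> 0}"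

definition MPSC_SSOCQ :: "('n::finite) mpsc \<Rightarrow> real^'n \<Rightarrow> bool"
  where "MPSC_SSOCQ P x \<longleftrightarrow>
    (\<forall>d\<in>linearization_cone P x. d \<noteq> 0 \<longrightarrow>
      (\<exists>\<delta>>0. \<exists>J K. \<exists>\<xi> :: real \<Rightarrow> real^'n.
        J \<subseteq> I_GH P x \<and> K \<subseteq> I_GH P x \<and>
        twice_differentiable_arc_on \<xi> {0..<\<delta>} \<and>
        (\<forall>t\<in>{0..<\<delta>}. \<xi> t \<in> feasible_set P) \<and>
        \<xi> 0 = x \<and> (\<xi> has_vector_derivative d) (at_right 0) \<and>
        (\<forall>t\<in>{0..<\<delta>}.
          (\<forall>i\<in>{i\<in>I_g P x. grad (ineq P i) x \<bullet> d = 0}. ineq P i (\<xi> t) = 0) \<and>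
          (\<forall>k\<in>I_G P x \<union> J. swG P k (\<xi> t) = 0) \<and>
          (\<forall>k\<in>I_H P x \<union> K. swH P k (\<xi> t) = 0))))"

definition MPSC_SSONC :: "('n::finite) mpsc \<Rightarrow> real^'n \<Rightarrow> bool"
  where "MPSC_SSONC P x \<longleftrightarrow>
    (\<forall>lam \<rho> \<mu> \<nu>. S_stationarity_system P x lam \<rho> \<mu> \<nu> \<longrightarrow>
      (\<forall>d\<in>critical_cone P x. 0 \<le> d \<bullet> (hessian (\<lambda>y. lagrangian P y lam \<rho> \<mu> \<nu>) x *v d)))"

end

theory Submission
  imports Defs
begin

text \<open>
  Restrict the Lagrangian \<open>L\<close> of a given multiplier to an arc \<open>\<xi>\<close> that the constraint
  qualification provides for a nonzero critical direction \<open>d\<close>. Complementarity and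
  stationarity force \<open>lam i = 0\<close> for every inequality that does not stay active along \<open>\<xi>\<close>
  (lemma \<open>critical_direction_active\<close>), and the remaining terms of \<open>L\<close> vanish on \<open>\<xi>\<close> because
  the equations and switching constraints with a nonzero multiplier do
  (lemma \<open>lagrangian_eq_obj\<close>). Hence \<open>L\<close> agrees with the objective on \<open>\<xi>\<close>, and
  \<open>\<phi> t = L (\<xi> t)\<close> has a one-sided local minimum at \<open>0\<close>.

  As the gradient of \<open>L\<close> vanishes at \<open>x\<close>, the first derivative of \<open>\<phi>\<close> at \<open>0\<close> is \<open>0\<close>, and in
  the second derivative the term with the curvature of \<open>\<xi>\<close> drops out. What is left is the
  quadratic form of the Hessian of \<open>L\<close> at \<open>d\<close>, which the minimality makes nonnegative
  (lemma \<open>second_order_necessary_along_arc\<close>).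
\<close>

section \<open>Gradients\<close>

lemma grad_eqI:
  assumes "GDERIV f x :> D"
  shows "grad f x = D"
  unfolding grad_def
proof (rule the_equality)
  fix E assume "GDERIV f x :> E"
  with assms have "(\<lambda>h. h \<bullet> E) = (\<lambda>h. h \<bullet> D)"
    unfolding gderiv_def by (metis has_derivative_unique)
  then show "E = D"
    by (metis inner_commute vector_eq_rdot)
qed (rule assms)

lemma differentiable_imp_GDERIV_grad:
  fixes f :: "'a::euclidean_space \<Rightarrow> real"
  assumes "f differentiable (at x)"
  shows "GDERIV f x :> grad f x"
proof -
  obtain f' where f': "(f has_derivative f') (at x)"
    using assms by (auto simp: differentiable_def)
  have lin: "linear f'"
    using f' by (rule has_derivative_linear)
  \<comment> \<open>The Riesz representative of the derivative.\<close>
  define D where "D = (\<Sum>b\<in>Basis. f' b *\<^sub>R b)"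
  have "f' h = h \<bullet> D" for h
  proof -
    have "f' h = f' (\<Sum>b\<in>Basis. (h \<bullet> b) *\<^sub>R b)"
      by (simp add: euclidean_representation)
    also have "\<dots> = (\<Sum>b\<in>Basis. (h \<bullet> b) * f' b)"
      using lin by (simp add: linear_sum linear_cmul)
    also have "\<dots> = h \<bullet> D"
      by (simp add: D_def inner_sum_right mult.commute)
    finally show ?thesis .
  qed
  then have "f' = (\<lambda>h. h \<bullet> D)"
    by auto
  then have "GDERIV f x :> D"
    using f' by (simp add: gderiv_def)
  then show ?thesis
    using grad_eqI by metis
qed

lemma GDERIV_lagrangian:
  assumes "C2_mpsc P"
  shows "GDERIV (\<lambda>y. lagrangian P y lam \<rho> \<mu> \<nu>) y :>
    grad (obj P) y + (\<Sum>i=1..nineq P. lam i *\<^sub>R grad (ineq P i) y)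
      + (\<Sum>j=1..neqn P. \<rho> j *\<^sub>R grad (eqn P j) y)
      + (\<Sum>k=1..nsw P. \<mu> k *\<^sub>R grad (swG P k) y) + (\<Sum>k=1..nsw P. \<nu> k *\<^sub>R grad (swH P k) y)"
proof -
  have d: "(f has_derivative (\<lambda>h. h \<bullet> grad f y)) (at y)" if "C2 f" for f :: "real^'a \<Rightarrow> real"
    using that differentiable_imp_GDERIV_grad[of f y] by (simp add: C2_def gderiv_def)
  have t: "((\<lambda>y. \<Sum>i=1..N. c i * F i y) has_derivative
        (\<lambda>h. h \<bullet> (\<Sum>i=1..N. c i *\<^sub>R grad (F i) y))) (at y)"
    if "\<forall>i\<in>{1..N}. C2 (F i)" for N c and F :: "nat \<Rightarrow> real^'a \<Rightarrow> real"
  proof -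
    have "((\<lambda>y. \<Sum>i=1..N. c i * F i y) has_derivative
        (\<lambda>h. \<Sum>i=1..N. c i * (h \<bullet> grad (F i) y))) (at y)"
      using that by (intro has_derivative_sum has_derivative_mult_right d) auto
    then show ?thesis
      by (simp add: inner_sum_right)
  qed
  show ?thesis
    unfolding gderiv_def lagrangian_def inner_add_right
    using assms unfolding C2_mpsc_def
    by (intro has_derivative_add d t) auto
qed

lemmas grad_lagrangian = grad_eqI[OF GDERIV_lagrangian]

lemma grad_lagrangian_differentiable:
  assumes "C2_mpsc P"
  shows "grad (\<lambda>y. lagrangian P y lam \<rho> \<mu> \<nu>) differentiable (at x)"
proof -
  have t: "(\<lambda>y. \<Sum>i=1..N. c i *\<^sub>R grad (F i) y) differentiable (at x)"
    if "\<forall>i\<in>{1..N}. C2 (F i)" for N c and F :: "nat \<Rightarrow> real^'a \<Rightarrow> real"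
    using that by (intro differentiable_sum differentiable_scaleR) (auto simp: C2_def)
  have "grad (\<lambda>y. lagrangian P y lam \<rho> \<mu> \<nu>) = (\<lambda>y.
      grad (obj P) y + (\<Sum>i=1..nineq P. lam i *\<^sub>R grad (ineq P i) y)
      + (\<Sum>j=1..neqn P. \<rho> j *\<^sub>R grad (eqn P j) y)
      + (\<Sum>k=1..nsw P. \<mu> k *\<^sub>R grad (swG P k) y) + (\<Sum>k=1..nsw P. \<nu> k *\<^sub>R grad (swH P k) y))"
    using grad_lagrangian[OF assms] by blast
  moreover have "\<dots> differentiable (at x)"
    using assms unfolding C2_mpsc_def
    by (intro differentiable_add t) (auto simp: C2_def)
  ultimately show ?thesis
    by simp
qed

section \<open>Second-order conditions along an arc\<close>

text \<open>
  If the second derivative were negative, the derivative would decrease from \<open>0\<close> to negative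
  values right after \<open>0\<close>, so that \<open>\<phi>\<close> itself would fall below \<open>\<phi> 0\<close>.
\<close>

lemma second_order_necessary_right:
  fixes \<phi> \<phi>' :: "real \<Rightarrow> real"
  assumes "\<delta> > 0"
    and deriv: "\<And>t. t \<in> {0..<\<delta>} \<Longrightarrow> (\<phi> has_real_derivative \<phi>' t) (at t within {0..<\<delta>})"
    and deriv2: "(\<phi>' has_real_derivative q) (at 0 within {0..<\<delta>})"
    and "\<phi>' 0 = 0"
    and min: "\<forall>\<^sub>F t in at_right 0. \<phi> 0 \<le> \<phi> t"
  shows "0 \<le> q"
proof (rule ccontr)
  assume "\<not> 0 \<le> q"
  then obtain e where e: "e > 0" "\<And>h. h > 0 \<Longrightarrow> h \<in> {0..<\<delta>} \<Longrightarrow> h < e \<Longrightarrow> \<phi>' h < 0"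
    using has_real_derivative_neg_dec_right[OF deriv2] \<open>\<phi>' 0 = 0\<close> by fastforce
  obtain b where b: "b > 0" "\<And>t. 0 < t \<Longrightarrow> t < b \<Longrightarrow> \<phi> 0 \<le> \<phi> t"
    using min by (auto simp: eventually_at_right_field)
  define t where "t = min (min e b) \<delta> / 2"
  have t: "0 < t" "t < e" "t < b" "t < \<delta>"
    using e(1) b(1) \<open>\<delta> > 0\<close> by (auto simp: t_def)
  have "(\<phi> has_derivative (\<lambda>h. \<phi>' s * h)) (at s within {0..t})" if "0 \<le> s" "s \<le> t" for s
    using deriv[of s] that t(4)
    by (auto simp: has_field_derivative_def intro: has_derivative_subset)
  then obtain s where s: "s \<in> {0<..<t}" "\<phi> t - \<phi> 0 = \<phi>' s * (t - 0)"
    using mvt_simple[OF t(1), of \<phi> "\<lambda>s h. \<phi>' s * h"] by blast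
  have "\<phi>' s * t < 0"
    using e(2)[of s] s(1) t by (auto intro: mult_neg_pos)
  then show False
    using s(2) b(2)[OF t(1) t(3)] by simp
qed

lemma second_order_necessary_along_arc:
  fixes L :: "real^'n \<Rightarrow> real" and \<xi> :: "real \<Rightarrow> real^'n"
  assumes L: "\<And>y. GDERIV L y :> grad L y"
    and gradL: "grad L differentiable (at x)" and stat: "grad L x = 0"
    and "\<delta> > 0" and arc: "twice_differentiable_arc_on \<xi> {0..<\<delta>}"
    and "\<xi> 0 = x" and d: "(\<xi> has_vector_derivative d) (at_right 0)"
    and min: "\<forall>\<^sub>F t in at_right 0. L x \<le> L (\<xi> t)"
  shows "0 \<le> d \<bullet> (hessian L x *v d)"
proof -
  let ?S = "{0..<\<delta>}"
  obtain \<xi>' where \<xi>': "\<And>t. t \<in> ?S \<Longrightarrow> (\<xi> has_vector_derivative \<xi>' t) (at t within ?S)"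
    and "\<xi>' differentiable_on ?S"
    using arc unfolding twice_differentiable_arc_on_def by blast
  then obtain w where w: "(\<xi>' has_vector_derivative w) (at 0 within ?S)"
    using \<open>\<delta> > 0\<close> unfolding differentiable_on_def vector_derivative_works
    by (meson atLeastLessThan_iff order_refl)
  have at0: "at 0 within ?S = at_right (0::real)"
    using \<open>\<delta> > 0\<close> by (intro at_within_nhd[of 0 "{..<\<delta>}"]) auto
  have "\<xi>' 0 = d"
    using \<xi>'[of 0] d \<open>\<delta> > 0\<close> vector_derivative_unique_within[of 0 "{0<..}"]
    by (auto simp: at0)
  show ?thesis
  proof (rule second_order_necessary_right[OF \<open>\<delta> > 0\<close>])
    fix t assume "t \<in> ?S"
    then show "((\<lambda>t. L (\<xi> t)) has_real_derivative \<xi>' t \<bullet> grad L (\<xi> t)) (at t within ?S)"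
      using has_derivative_compose[OF \<xi>'[unfolded has_vector_derivative_def] L[unfolded gderiv_def]]
      by (simp add: has_field_derivative_def mult.commute[of _ "_ \<bullet> _"])
  next
    have "(grad L has_derivative (\<lambda>h. hessian L x *v h)) (at (\<xi> 0))"
      using gradL \<open>\<xi> 0 = x\<close> by (simp add: jacobian_works hessian_def)
    from has_derivative_compose[OF \<xi>'[of 0, unfolded has_vector_derivative_def] this]
    have g: "((\<lambda>t. grad L (\<xi> t)) has_derivative (\<lambda>s. s *\<^sub>R (hessian L x *v d))) (at 0 within ?S)"
      using \<open>\<delta> > 0\<close> \<open>\<xi>' 0 = d\<close> by (simp add: matrix_vector_mult_scaleR)
    \<comment> \<open>The curvature \<open>w\<close> of the arc is paired with the vanishing gradient.\<close>
    show "((\<lambda>t. \<xi>' t \<bullet> grad L (\<xi> t)) has_real_derivative d \<bullet> (hessian L x *v d)) (at 0 within ?S)"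
      using has_derivative_inner[OF w[unfolded has_vector_derivative_def] g]
        \<open>\<xi> 0 = x\<close> \<open>\<xi>' 0 = d\<close> stat
      by (simp add: has_field_derivative_def mult.commute[of _ "_ \<bullet> _"])
  qed (use \<open>\<xi> 0 = x\<close> stat min in auto)
qed

section \<open>The Lagrangian and the objective\<close>

lemma switching_index_cases:
  assumes "x \<in> feasible_set P" and "k \<in> {1..nsw P}"
  shows "k \<in> I_G P x \<or> k \<in> I_H P x \<or> k \<in> I_GH P x"
  using assms by (auto simp: feasible_set_def I_G_def I_H_def I_GH_def)

lemma complementarity:
  assumes "S_stationarity_system P x lam \<rho> \<mu> \<nu>" and "x \<in> feasible_set P"
    and "i \<in> {1..nineq P}" "lam i \<noteq> 0"
  shows "i \<in> I_g P x"
proof -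
  have "\<forall>i\<in>{1..nineq P}. 0 \<le> - (lam i * ineq P i x)"
    using assms(1,2)
    by (auto simp: S_stationarity_system_def feasible_set_def mult_nonneg_nonpos)
  moreover have "(\<Sum>i=1..nineq P. - (lam i * ineq P i x)) = 0"
    using assms(1) by (simp add: S_stationarity_system_def sum_negf)
  ultimately have "- (lam i * ineq P i x) = 0"
    using sum_nonneg_eq_0_iff[of "{1..nineq P}" "\<lambda>i. - (lam i * ineq P i x)"] assms(3) by blast
  then show ?thesis
    using assms(3,4) by (simp add: I_g_def)
qed

text \<open>
  Pairing the stationarity equation with \<open>d\<close> annihilates the equations and switching
  constraints and leaves a sum of nonpositive numbers that equals \<open>0\<close>, so each of them is \<open>0\<close>.
\<close>

lemma critical_direction_active:
  assumes C2: "C2_mpsc P" and feas: "x \<in> feasible_set P"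
    and sys: "S_stationarity_system P x lam \<rho> \<mu> \<nu>"
    and d: "d \<in> critical_cone P x"
    and i: "i \<in> {1..nineq P}" "lam i \<noteq> 0"
  shows "grad (ineq P i) x \<bullet> d = 0"
proof -
  let ?a = "\<lambda>i. - (lam i * (grad (ineq P i) x \<bullet> d))"
  have sw: "\<mu> k * (grad (swG P k) x \<bullet> d) = 0" "\<nu> k * (grad (swH P k) x \<bullet> d) = 0"
    if "k \<in> {1..nsw P}" for k
    using switching_index_cases[OF feas that] sys d
    by (auto simp: S_stationarity_system_def critical_cone_def linearization_cone_def)
  have "(\<Sum>j=1..neqn P. \<rho> j * (grad (eqn P j) x \<bullet> d)) = 0"
    using d by (auto simp: critical_cone_def linearization_cone_def I_h_def)
  moreover have "(\<Sum>k=1..nsw P. \<mu> k * (grad (swG P k) x \<bullet> d)) = 0"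
      "(\<Sum>k=1..nsw P. \<nu> k * (grad (swH P k) x \<bullet> d)) = 0"
    using sw by (blast intro: sum.neutral)+
  moreover have "grad (\<lambda>y. lagrangian P y lam \<rho> \<mu> \<nu>) x \<bullet> d = 0"
    using sys by (simp add: S_stationarity_system_def)
  ultimately have "grad (obj P) x \<bullet> d + (\<Sum>i=1..nineq P. lam i * (grad (ineq P i) x \<bullet> d)) = 0"
    by (simp add: grad_lagrangian[OF C2] inner_add_left inner_sum_left)
  moreover have "grad (obj P) x \<bullet> d \<le> 0"
    using d by (simp add: critical_cone_def)
  ultimately have le: "sum ?a {1..nineq P} \<le> 0"
    by (simp add: sum_negf)
  have nonneg: "0 \<le> ?a i" if "i \<in> {1..nineq P}" for i
  proof (cases "lam i = 0")
    case False
    then have "grad (ineq P i) x \<bullet> d \<le> 0"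
      using complementarity[OF sys feas that] d
      by (auto simp: critical_cone_def linearization_cone_def)
    moreover have "0 \<le> lam i"
      using sys that by (auto simp: S_stationarity_system_def)
    ultimately show ?thesis
      by (simp add: mult_nonneg_nonpos)
  qed simp
  have "sum ?a {1..nineq P} = 0"
    using le sum_nonneg[of "{1..nineq P}" ?a] nonneg by force
  then have "?a i = 0"
    using sum_nonneg_eq_0_iff[of "{1..nineq P}" ?a] nonneg i(1) by blast
  then show ?thesis
    using i(2) by simp
qed

lemma lagrangian_eq_obj:
  assumes feas: "x \<in> feasible_set P" and y: "y \<in> feasible_set P"
    and sys: "S_stationarity_system P x lam \<rho> \<mu> \<nu>"
    and g: "\<And>i. i \<in> {1..nineq P} \<Longrightarrow> lam i \<noteq> 0 \<Longrightarrow> ineq P i y = 0"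
    and G: "\<And>k. k \<in> I_G P x \<Longrightarrow> swG P k y = 0"
    and H: "\<And>k. k \<in> I_H P x \<Longrightarrow> swH P k y = 0"
  shows "lagrangian P y lam \<rho> \<mu> \<nu> = obj P y"
proof -
  have sw: "\<mu> k * swG P k y = 0" "\<nu> k * swH P k y = 0" if "k \<in> {1..nsw P}" for k
    using switching_index_cases[OF feas that] sys G[of k] H[of k]
    by (auto simp: S_stationarity_system_def)
  have "(\<Sum>i=1..nineq P. lam i * ineq P i y) = 0"
    using g by (intro sum.neutral) (metis mult_eq_0_iff)
  moreover have "(\<Sum>j=1..neqn P. \<rho> j * eqn P j y) = 0"
    using y by (intro sum.neutral) (auto simp: feasible_set_def)
  moreover have "(\<Sum>k=1..nsw P. \<mu> k * swG P k y) = 0" "(\<Sum>k=1..nsw P. \<nu> k * swH P k y) = 0"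
    using sw by (blast intro: sum.neutral)+
  ultimately show ?thesis
    by (simp add: lagrangian_def)
qed

section \<open>The second-order necessary condition\<close>

theorem theorem5p1:
  fixes P :: "('n::finite) mpsc" and x :: "real^'n"
  assumes "C2_mpsc P"
    and "x \<in> feasible_set P"
    and "locally_optimal P x"
    and "S_stationary P x"
    and "MPSC_SSOCQ P x"
  shows "MPSC_SSONC P x"
  unfolding MPSC_SSONC_def
proof (intro allI impI ballI)
  fix lam \<rho> \<mu> \<nu> d
  assume sys: "S_stationarity_system P x lam \<rho> \<mu> \<nu>" and d: "d \<in> critical_cone P x"
  let ?L = "\<lambda>y. lagrangian P y lam \<rho> \<mu> \<nu>"
  show "0 \<le> d \<bullet> (hessian ?L x *v d)"
  proof (cases "d = 0")
    case False
    have "d \<in> linearization_cone P x"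
      using d by (simp add: critical_cone_def)
    from bspec[OF \<open>MPSC_SSOCQ P x\<close>[unfolded MPSC_SSOCQ_def] this, THEN mp, OF False]
    obtain \<delta> J K \<xi> where "\<delta> > 0"
      and arc: "twice_differentiable_arc_on \<xi> {0..<\<delta>}"
      and feas: "\<forall>t\<in>{0..<\<delta>}. \<xi> t \<in> feasible_set P"
      and start: "\<xi> 0 = x" and dir: "(\<xi> has_vector_derivative d) (at_right 0)"
      and active: "\<forall>t\<in>{0..<\<delta>}.
          (\<forall>i\<in>{i\<in>I_g P x. grad (ineq P i) x \<bullet> d = 0}. ineq P i (\<xi> t) = 0) \<and>
          (\<forall>k\<in>I_G P x \<union> J. swG P k (\<xi> t) = 0) \<and>
          (\<forall>k\<in>I_H P x \<union> K. swH P k (\<xi> t) = 0)"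
      by (elim exE conjE) (rule that)
    have L_eq: "?L (\<xi> t) = obj P (\<xi> t)" if "t \<in> {0..<\<delta>}" for t
    proof (rule lagrangian_eq_obj[OF assms(2) _ sys])
      fix i assume i: "i \<in> {1..nineq P}" "lam i \<noteq> 0"
      then show "ineq P i (\<xi> t) = 0"
        using active that complementarity[OF sys assms(2) i]
          critical_direction_active[OF assms(1,2) sys d i] by blast
    qed (use feas active that in auto)
    obtain \<epsilon> where "\<epsilon> > 0" and opt: "\<And>y. y \<in> feasible_set P \<inter> ball x \<epsilon> \<Longrightarrow> obj P x \<le> obj P y"
      using assms(3) by (auto simp: locally_optimal_def)
    have "(\<xi> \<longlongrightarrow> x) (at_right 0)"
      using has_vector_derivative_continuous[OF dir] start by (simp add: continuous_within)
    then have "\<forall>\<^sub>F t in at_right 0. dist (\<xi> t) x < \<epsilon>"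
      using \<open>\<epsilon> > 0\<close> by (rule tendstoD)
    moreover have "\<forall>\<^sub>F t in at_right 0. t \<in> {0<..<\<delta>}"
      using \<open>\<delta> > 0\<close> by (rule eventually_at_right_real)
    ultimately have min: "\<forall>\<^sub>F t in at_right 0. ?L x \<le> ?L (\<xi> t)"
    proof eventually_elim
      case (elim t)
      then have "obj P x \<le> obj P (\<xi> t)"
        using opt feas by (auto simp: dist_commute)
      then show ?case
        using L_eq[of t] L_eq[of 0] elim start \<open>\<delta> > 0\<close> by simp
    qed
    have "GDERIV ?L y :> grad ?L y" for y
      unfolding grad_lagrangian[OF assms(1)] by (rule GDERIV_lagrangian[OF assms(1)])
    moreover have "grad ?L x = 0"
      using sys by (simp add: S_stationarity_system_def)
    ultimately show ?thesis
      using second_order_necessary_along_arc[OF _ grad_lagrangian_differentiable[OF assms(1)] _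
          \<open>\<delta> > 0\<close> arc start dir min] by blast
  qed simp
qed

end
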